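(* Let $n\ge2$. For a permutation $\tau\in\mathfrak S_n$ with $\tau\neq\mathrm{id}$, let $j+1$ be the smallest element of $\{1,\dots,n\}$ not fixed by $\tau$, and let $i$ be defined by $\tau_i=j+1$ (so $i>j+1$). Define $\mathbf f_\tau:\mathfrak S_n\to\mathbb R$ by $\mathbf f_\tau(\sigma)=1$ if $(\sigma_{j+1}\sigma_{j+2}\cdots\sigma_n)$ is in the same relative order as $(\tau_{j+1}\tau_{j+2}\cdots\tau_n)$; $\mathbf f_\tau(\sigma)=-1$ if $(\sigma_{j+1}\cdots\sigma_n)$ is in the same relative order as $((j+1)\tau_{j+1}\cdots\tau_{i-1}\tau_{i+1}\cdots\tau_n)$; and $\mathbf f_\tau(\sigma)=0$ otherwise. Set $\mathbf f_{\mathrm{id}}\equiv1$ (with $j=n$). Then each $\mathbf f_\tau$ is a right eigenfunction of the top-to-random-with-standardisation chain with eigenvalue $\beta_j=\frac jn$, and of the binomial-top-to-random-with-standardisation chain with parameter $q_2$ with eigenvalue $\beta_j=q_2^{n-j}$, and $\{\mathbf f_\tau:\tau\in\mathfrak S_n\}$ is a basis of the space of functions $\mathfrak S_n\to\mathbb R$.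
   Context: Permutations are written in one-line notation $\sigma=(\sigma_1\cdots\sigma_n)$. Two strings of distinct numbers of the same length are in the same relative order if their standardisations coincide, where the standardisation of a string of distinct numbers replaces its letters by $1,2,\dots$ preserving relative order. Top-to-random-with-standardisation chain on $\mathfrak S_n$: from $\sigma$, remove the first letter $\sigma_1$, replace the remaining letters by $2,\dots,n$ preserving their relative order, then insert the letter $1$ into one of the $n$ positions chosen uniformly. Binomial-top-to-random-with-standardisation chain with parameter $q_2\in[0,1]$: choose $r\sim\mathrm{Binomial}(n,1-q_2)$, remove the first $r$ letters, replace the remaining letters by $r+1,\dots,n$ preserving their relative order, then insert the letters $1,\dots,r$ so that the result is uniformly distributed among the $n!/(n-r)!$ permutations of $\mathfrak S_n$ in which the letters $r+1,\dots,n$ appear in that relative order. A right eigenfunction with eigenvalue $\beta$ of a chain with transition matrix $K$ is $\mathbf f$ with $\sum_yK(x,y)\mathbf f(y)=\beta\mathbf f(x)$. *)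

theory Defs
  imports
    "HOL-Combinatorics.Multiset_Permutations"
    "HOL-Library.Function_Algebras"
    "HOL-Probability.Probability_Mass_Function"
begin

text \<open>Permutations of \<open>{1..n}\<close> are lists in one-line notation. Letters are numbered from 1, so
  the letter \<open>\<sigma>\<^sub>k\<close> is \<open>\<sigma> ! (k - 1)\<close>, and \<open>drop j \<sigma>\<close> is the string \<open>\<sigma>\<^sub>j\<^sub>+\<^sub>1 \<dots> \<sigma>\<^sub>n\<close>.\<close>

abbreviation perms :: "nat \<Rightarrow> nat list set" where
  "perms n \<equiv> permutations_of_set {1..n}"

definition id_perm :: "nat \<Rightarrow> nat list" where
  "id_perm n = [1..<Suc n]"

definition letter :: "nat list \<Rightarrow> nat \<Rightarrow> nat" where
  "letter \<sigma> k = \<sigma> ! (k - 1)"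

definition standardise :: "nat list \<Rightarrow> nat list" where
  "standardise xs = map (\<lambda>x. card {y \<in> set xs. y \<le> x}) xs"

definition same_relative_order :: "nat list \<Rightarrow> nat list \<Rightarrow> bool" where
  "same_relative_order xs ys \<longleftrightarrow> standardise xs = standardise ys"

definition remove_top :: "nat \<Rightarrow> nat list \<Rightarrow> nat list" where
  "remove_top r \<sigma> = map ((+) r) (standardise (drop r \<sigma>))"

definition insert_at :: "nat \<Rightarrow> nat \<Rightarrow> nat list \<Rightarrow> nat list" where
  "insert_at p a xs = take p xs @ a # drop p xs"

definition top_to_random_std :: "nat \<Rightarrow> nat list \<Rightarrow> nat list pmf" where
  "top_to_random_std n \<sigma> = map_pmf (\<lambda>p. insert_at p 1 (remove_top 1 \<sigma>)) (pmf_of_set {..<n})"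

definition binomial_top_to_random_std :: "nat \<Rightarrow> real \<Rightarrow> nat list \<Rightarrow> nat list pmf" where
  "binomial_top_to_random_std n q \<sigma> =
     bind_pmf (binomial_pmf n (1 - q))
       (\<lambda>r. pmf_of_set {\<rho> \<in> perms n. filter (\<lambda>a. r < a) \<rho> = remove_top r \<sigma>})"

definition transition_matrix :: "('a \<Rightarrow> 'a pmf) \<Rightarrow> 'a \<Rightarrow> 'a \<Rightarrow> real" where
  "transition_matrix step x y = pmf (step x) y"

definition right_eigenfunction ::
    "'a set \<Rightarrow> ('a \<Rightarrow> 'a \<Rightarrow> real) \<Rightarrow> real \<Rightarrow> ('a \<Rightarrow> real) \<Rightarrow> bool" where
  "right_eigenfunction S K \<beta> f \<longleftrightarrow> (\<forall>x\<in>S. (\<Sum>y\<in>S. K x y * f y) = \<beta> * f x)"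

definition fixed_prefix :: "nat \<Rightarrow> nat list \<Rightarrow> nat" where
  "fixed_prefix n \<tau> =
     (if \<tau> = id_perm n then n
      else (LEAST k. k \<in> {1..n} \<and> letter \<tau> k \<noteq> k) - 1)"

definition position :: "nat \<Rightarrow> nat list \<Rightarrow> nat \<Rightarrow> nat" where
  "position n \<tau> a = (THE i. i \<in> {1..n} \<and> letter \<tau> i = a)"

text \<open>The string \<open>drop j (take (i - 1) \<tau>)\<close> is \<open>\<tau>\<^sub>j\<^sub>+\<^sub>1 \<dots> \<tau>\<^sub>i\<^sub>-\<^sub>1\<close>. A function on \<open>perms n\<close> is
  represented by its extension by 0 to all lists.\<close>

definition eigfun :: "nat \<Rightarrow> nat list \<Rightarrow> nat list \<Rightarrow> real" where
  "eigfun n \<tau> \<sigma> =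
     (if \<sigma> \<notin> perms n then 0
      else if \<tau> = id_perm n then 1
      else
        let j = fixed_prefix n \<tau>; i = position n \<tau> (j + 1) in
          if same_relative_order (drop j \<sigma>) (drop j \<tau>) then 1
          else if same_relative_order (drop j \<sigma>)
                    ((j + 1) # drop j (take (i - 1) \<tau>) @ drop i \<tau>) then - 1
          else 0)"

definition fscale :: "real \<Rightarrow> ('a \<Rightarrow> real) \<Rightarrow> 'a \<Rightarrow> real" where
  "fscale c f = (\<lambda>x. c * f x)"

interpretation funs: vector_space "fscale :: real \<Rightarrow> ('a \<Rightarrow> real) \<Rightarrow> 'a \<Rightarrow> real"
  by unfold_locales (auto simp: fscale_def fun_eq_iff algebra_simps)

definition functions_on :: "'a set \<Rightarrow> ('a \<Rightarrow> real) set" where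
  "functions_on S = {f. \<forall>x. x \<notin> S \<longrightarrow> f x = 0}"

definition is_basis :: "('a \<Rightarrow> real) set \<Rightarrow> ('a \<Rightarrow> real) set \<Rightarrow> bool" where
  "is_basis B V \<longleftrightarrow> funs.independent B \<and> funs.span B = V"

end

theory Submission
  imports Defs
begin

text \<open>The function \<open>f\<^sub>\<tau>\<close> is a difference of two indicators of patterns of the last \<open>m = n - j\<close>
  letters, and these patterns differ only in the place of their smallest letter. Insert a new
  smallest letter at every position of a word. At a position in front of the last \<open>m\<close> letters of the
  new word it does not change the value of \<open>f\<^sub>\<tau>\<close>, and over the other \<open>m\<close> positions each of the two
  indicators is counted once, so that they cancel. So summing \<open>f\<^sub>\<tau>\<close> over the insertions multiplies
  it by the number of positions that are left over. One insertion gives the eigenvalue \<open>j / n\<close>;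
  inserting \<open>r, r - 1, \<dots>, 1\<close> in turn gives the falling factorial of \<open>j\<close> of order \<open>r\<close>, and the
  binomial average is evaluated by the binomial theorem.

  Eigenfunctions for distinct eigenvalues \<open>j / n\<close> are independent, and among the \<open>\<tau>\<close> with a common
  \<open>j\<close> the matrix of values \<open>f\<^sub>\<tau>(\<sigma>)\<close> is the identity, since no such \<open>\<sigma>\<close> has the letter
  \<open>j + 1\<close> in position \<open>j + 1\<close>. A dimension count then gives a basis.\<close>

subsection \<open>Independent families of eigenvectors\<close>

context vector_space
begin

text \<open>Without the prefix \<open>local\<close> the names below denote the instances for real vector spaces.\<close>

definition independent_family :: "('i \<Rightarrow> 'b) \<Rightarrow> 'i set \<Rightarrow> bool" where
  "independent_family v I \<longleftrightarrow> (\<forall>c. (\<Sum>i\<in>I. scale (c i) (v i)) = 0 \<longrightarrow> (\<forall>i\<in>I. c i = 0))"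

lemma independent_family_imp_inj_on:
  fixes v :: "'i \<Rightarrow> 'b"
  assumes "finite I" "local.independent_family v I"
  shows "inj_on v I"
proof (rule inj_onI, rule ccontr)
  fix i k assume indices: "i \<in> I" "k \<in> I" "v i = v k" "i \<noteq> k"
  define c :: "'i \<Rightarrow> 'a" where "c l = (if l = i then 1 else 0) - (if l = k then 1 else 0)" for l
  have "(\<Sum>l\<in>I. scale (c l) (v l)) = v i - v k"
    using assms(1) indices(1,2)
    by (simp add: c_def scale_left_diff_distrib sum_subtractf if_distrib[of "\<lambda>a. scale a _"] cong: if_cong)
  then have "c i = 0" using assms(2) indices by (auto simp: independent_family_def)
  then show False using indices(4) by (simp add: c_def)
qed

lemma independent_family_imp_independent_image:
  assumes "finite I" "local.independent_family v I"
  shows "local.independent (v ` I)"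
proof (rule independent_if_scalars_zero)
  fix c x assume "(\<Sum>x\<in>v ` I. scale (c x) x) = 0" "x \<in> v ` I"
  then show "c x = 0"
    using assms(2) sum.reindex[OF independent_family_imp_inj_on[OF assms], of "\<lambda>x. scale (c x) x"]
    by (auto simp: independent_family_def dest!: spec[of _ "c \<circ> v"])
qed (simp add: assms(1))

lemma eigenvectors_sum_eq_0:
  assumes "Vector_Spaces.linear scale scale T" "finite J" "inj_on \<beta> J"
    and "\<And>j. j \<in> J \<Longrightarrow> T (v j) = scale (\<beta> j) (v j)" "(\<Sum>j\<in>J. v j) = 0" "j \<in> J"
  shows "v j = 0"
proof -
  interpret T: Vector_Spaces.linear scale scale T by (rule assms(1))
  show ?thesis using assms(2-)
  proof (induction J arbitrary: v j rule: finite_induct)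
    case (insert k J)
    define w where "w i = scale (\<beta> i - \<beta> k) (v i)" for i
    have w_eq_0: "w i = 0" if "i \<in> J" for i
    proof (rule insert.IH[OF _ _ _ that])
      show "inj_on \<beta> J" using insert.prems(1) by simp
      show "T (w i) = scale (\<beta> i) (w i)" if "i \<in> J" for i
        using insert.prems(2) that by (simp add: w_def T.scale mult.commute)
      have "(\<Sum>i\<in>J. w i) = (\<Sum>i\<in>insert k J. scale (\<beta> i) (v i)) - scale (\<beta> k) (\<Sum>i\<in>insert k J. v i)"
        unfolding scale_sum_right sum_subtractf[symmetric] using insert.hyps
        by (simp add: w_def scale_left_diff_distrib)
      also have "(\<Sum>i\<in>insert k J. scale (\<beta> i) (v i)) = T (\<Sum>i\<in>insert k J. v i)"
        by (simp only: T.sum) (simp add: insert.prems(2))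
      finally show "(\<Sum>i\<in>J. w i) = 0" by (simp only: insert.prems(3) T.zero scale_zero_right) simp
    qed
    have v_eq_0: "v i = 0" if "i \<in> J" for i
    proof -
      have "\<beta> i \<noteq> \<beta> k" using insert.prems(1) insert.hyps that by (auto simp: inj_on_def)
      then show ?thesis using w_eq_0[OF that] by (simp add: w_def)
    qed
    then have "v k = 0" using insert.prems(3) insert.hyps by simp
    with v_eq_0 show ?case using insert.prems(4) by auto
  qed simp
qed

lemma independent_family_eigenvectors:
  assumes "Vector_Spaces.linear scale scale T" "finite I" "inj_on \<beta> (d ` I)"
    and "\<And>i. i \<in> I \<Longrightarrow> T (v i) = scale (\<beta> (d i)) (v i)"
    and "\<And>j. j \<in> d ` I \<Longrightarrow> local.independent_family v {i \<in> I. d i = j}"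
  shows "local.independent_family v I"
  unfolding independent_family_def
proof (intro allI impI ballI)
  interpret T: Vector_Spaces.linear scale scale T by (rule assms(1))
  fix c i assume combination: "(\<Sum>i\<in>I. scale (c i) (v i)) = 0" and i: "i \<in> I"
  define w where "w j = (\<Sum>i | i \<in> I \<and> d i = j. scale (c i) (v i))" for j
  have "T (w j) = scale (\<beta> j) (w j)" for j
    by (simp add: w_def T.sum T.scale assms(4) scale_sum_right mult.commute)
  moreover have "(\<Sum>j\<in>d ` I. w j) = 0"
    unfolding w_def using assms(2) combination by (simp add: sum.group)
  ultimately have "w (d i) = 0"
    using assms(2) i by (intro eigenvectors_sum_eq_0[OF assms(1) _ assms(3), where v = w]) simp_all
  then show "c i = 0"
    using assms(5)[of "d i"] i unfolding w_def independent_family_def by blast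
qed

lemma subset_span_if_card_ge:
  assumes "finite D" "V \<subseteq> local.span D" "local.independent B" "B \<subseteq> V" "card D \<le> card B"
  shows "V \<subseteq> local.span B"
proof -
  obtain B' where B': "B \<subseteq> B'" "B' \<subseteq> V" "local.independent B'" "V \<subseteq> local.span B'"
    using maximal_independent_subset_extend[OF assms(4,3)] by blast
  then have "finite B'" "card B' \<le> card D"
    using independent_span_bound[OF assms(1), of B'] assms(2) by auto
  then have "B = B'" using B'(1) assms(5) by (intro card_seteq) auto
  with B'(4) show ?thesis by simp
qed

end

subsection \<open>Functions on a finite set\<close>

lemma sum_fun_apply: "(\<Sum>i\<in>A. f i) x = (\<Sum>i\<in>A. f i x)"
  for f :: "'i \<Rightarrow> 'a \<Rightarrow> 'b::comm_monoid_add"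
  by (induction A rule: infinite_finite_induct) auto

lemma funs_independent_family_if_dual_points:
  assumes "finite I" "\<And>i k. i \<in> I \<Longrightarrow> k \<in> I \<Longrightarrow> f i (x k) = of_bool (i = k)"
  shows "funs.independent_family f I"
  unfolding funs.independent_family_def
proof (intro allI impI ballI)
  fix c k assume "(\<Sum>i\<in>I. fscale (c i) (f i)) = 0" and k: "k \<in> I"
  then have "0 = (\<Sum>i\<in>I. c i * f i (x k))"
    using sum_fun_apply[of "\<lambda>i. fscale (c i) (f i)" I "x k"] by (simp add: fscale_def)
  also have "\<dots> = (\<Sum>i\<in>I. if i = k then c i else 0)"
    using assms(2) k by (intro sum.cong) auto
  finally show "c k = 0" using assms(1) k by simp
qed

lemma subspace_functions_on: "funs.subspace (functions_on S)"
  by (auto simp: funs.subspace_def functions_on_def fscale_def)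

lemma functions_on_subset_span_indicators:
  assumes "finite S"
  shows "functions_on S \<subseteq> funs.span ((\<lambda>s. indicator {s}) ` S)"
proof
  fix f :: "'a \<Rightarrow> real" assume "f \<in> functions_on S"
  then have "f x = (\<Sum>s\<in>S. fscale (f s) (indicator {s})) x" for x
    using assms
    by (cases "x \<in> S") (simp_all add: sum_fun_apply fscale_def indicator_def functions_on_def)
  then have "f = (\<Sum>s\<in>S. fscale (f s) (indicator {s}))" by blast
  also have "\<dots> \<in> funs.span ((\<lambda>s. indicator {s}) ` S)"
    by (intro funs.span_sum funs.span_scale funs.span_base) auto
  finally show "f \<in> funs.span ((\<lambda>s. indicator {s}) ` S)" .
qed

lemma is_basis_functions_on_if_card_eq:
  assumes "finite S" "B \<subseteq> functions_on S" "funs.independent B" "card B = card S"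
  shows "is_basis B (functions_on S)"
proof -
  have "functions_on S \<subseteq> funs.span B"
    using assms card_image_le[OF assms(1)]
    by (intro funs.subset_span_if_card_ge[OF _ functions_on_subset_span_indicators]) simp_all
  moreover have "funs.span B \<subseteq> functions_on S"
    using assms(2) subspace_functions_on by (rule funs.span_minimal)
  ultimately show ?thesis using assms(3) by (simp add: is_basis_def)
qed

lemma right_eigenfunction_cong:
  "(\<And>x. x \<in> S \<Longrightarrow> f x = g x) \<Longrightarrow> right_eigenfunction S K \<beta> f \<longleftrightarrow> right_eigenfunction S K \<beta> g"
  by (simp add: right_eigenfunction_def)

lemma right_eigenfunction_transition_matrixI:
  assumes "finite S" "\<And>x. x \<in> S \<Longrightarrow> set_pmf (step x) \<subseteq> S"
    and "\<And>x. x \<in> S \<Longrightarrow> measure_pmf.expectation (step x) f = \<beta> * f x"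
  shows "right_eigenfunction S (transition_matrix step) \<beta> f"
  unfolding right_eigenfunction_def transition_matrix_def
proof
  fix x assume x: "x \<in> S"
  have "measure_pmf.expectation (step x) f = (\<Sum>y\<in>S. pmf (step x) y *\<^sub>R f y)"
    using assms(1) assms(2)[OF x] by (intro integral_measure_pmf) auto
  then show "(\<Sum>y\<in>S. pmf (step x) y * f y) = \<beta> * f x"
    using assms(3)[OF x] by simp
qed

definition kernel_operator :: "'a set \<Rightarrow> ('a \<Rightarrow> 'a \<Rightarrow> real) \<Rightarrow> ('a \<Rightarrow> real) \<Rightarrow> 'a \<Rightarrow> real" where
  "kernel_operator S K f = (\<lambda>x. if x \<in> S then \<Sum>y\<in>S. K x y * f y else 0)"

lemma linear_kernel_operator: "Vector_Spaces.linear fscale fscale (kernel_operator S K)"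
  by unfold_locales
    (auto simp: kernel_operator_def fscale_def fun_eq_iff algebra_simps sum.distrib sum_distrib_left)

lemma right_eigenfunction_iff_kernel_operator:
  "f \<in> functions_on S \<Longrightarrow> right_eigenfunction S K \<beta> f \<longleftrightarrow> kernel_operator S K f = fscale \<beta> f"
  by (auto simp: functions_on_def right_eigenfunction_def kernel_operator_def fscale_def fun_eq_iff)

subsection \<open>Inserting a letter into a word\<close>

lemma length_insert_at [simp]: "length (insert_at p a xs) = Suc (length xs)"
  by (simp add: insert_at_def)

lemma insert_at_length_append [simp]: "insert_at (length us) a (us @ vs) = us @ a # vs"
  by (simp add: insert_at_def)

lemma set_insert_at [simp]: "set (insert_at p a xs) = insert a (set xs)"
proof -
  have "set (take p xs) \<union> set (drop p xs) = set xs"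
    by (metis append_take_drop_id set_append)
  then show ?thesis by (auto simp: insert_at_def)
qed

lemma distinct_insert_at [simp]: "distinct (insert_at p a xs) \<longleftrightarrow> a \<notin> set xs \<and> distinct xs"
proof -
  have "distinct (insert_at p a xs) \<longleftrightarrow> distinct (a # take p xs @ drop p xs)"
    unfolding insert_at_def distinct_append distinct.simps set_append by auto
  then show ?thesis by simp
qed

lemma map_insert_at: "map f (insert_at p a xs) = insert_at p (f a) (map f xs)"
  by (simp add: insert_at_def take_map drop_map)

lemma insert_at_inject:
  assumes "a \<notin> set xs" "a \<notin> set ys" "p \<le> length xs" "q \<le> length ys"
  shows "insert_at p a xs = insert_at q a ys \<longleftrightarrow> p = q \<and> xs = ys"
proof
  assume "insert_at p a xs = insert_at q a ys"
  moreover have "a \<notin> set (take p xs)" "a \<notin> set (take q ys)" "a \<notin> set (drop p xs)"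
    using assms by (auto dest: in_set_takeD in_set_dropD)
  ultimately have parts: "take p xs = take q ys" "drop p xs = drop q ys"
    by (auto simp: insert_at_def append_Cons_eq_iff)
  have "p = q"
    using arg_cong[OF parts(1), of length] assms by simp
  with parts show "p = q \<and> xs = ys"
    by (metis append_take_drop_id)
qed simp

lemma drop_insert_at_before:
  assumes "p < k" "p \<le> length xs"
  shows "drop k (insert_at p a xs) = drop (k - 1) xs"
  using assms by (simp add: insert_at_def drop_Cons' min_def)

lemma drop_insert_at_after:
  assumes "k \<le> p" "p \<le> length xs"
  shows "drop k (insert_at p a xs) = insert_at (p - k) a (drop k xs)"
  using assms by (simp add: insert_at_def drop_take)

lemma remove1_eq_iff_insert_at:
  assumes "a \<notin> set ys" "a \<in> set xs"
  shows "remove1 a xs = ys \<longleftrightarrow> (\<exists>p\<le>length ys. xs = insert_at p a ys)"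
proof
  assume "remove1 a xs = ys"
  then obtain us vs where "xs = us @ a # vs" "ys = us @ vs"
    using remove1_split[OF assms(2), of ys] by auto
  then show "\<exists>p\<le>length ys. xs = insert_at p a ys"
    by (intro exI[of _ "length us"]) simp
next
  assume "\<exists>p\<le>length ys. xs = insert_at p a ys"
  then obtain p where "xs = insert_at p a ys" by blast
  moreover have "a \<notin> set (take p ys)"
    using assms(1) by (auto dest: in_set_takeD)
  ultimately show "remove1 a xs = ys"
    by (simp add: insert_at_def remove1_append)
qed

subsection \<open>Standardisation\<close>

definition rank_in :: "'a::linorder set \<Rightarrow> 'a \<Rightarrow> nat" where
  "rank_in A x = card {y \<in> A. y \<le> x}"

lemma standardise_eq_map_rank_in: "standardise xs = map (rank_in (set xs)) xs"
  by (simp add: standardise_def rank_in_def)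

lemma strict_mono_on_rank_in:
  assumes "finite A"
  shows "strict_mono_on A (rank_in A)"
proof (rule strict_mono_onI)
  fix x y assume "x \<in> A" "y \<in> A" "x < y"
  then have "{z \<in> A. z \<le> x} \<subset> {z \<in> A. z \<le> y}" by force
  then show "rank_in A x < rank_in A y"
    using assms unfolding rank_in_def by (intro psubset_card_mono) auto
qed

lemma inj_on_rank_in: "finite A \<Longrightarrow> inj_on (rank_in A) A"
  by (intro strict_mono_on_imp_inj_on strict_mono_on_rank_in)

lemma rank_in_image:
  assumes "strict_mono_on A f" "x \<in> A"
  shows "rank_in (f ` A) (f x) = rank_in A x"
proof -
  have "{y \<in> f ` A. y \<le> f x} = f ` {y \<in> A. y \<le> x}"
    using strict_mono_on_leD[OF assms(1)] strict_mono_onD[OF assms(1)] assms(2)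
    by (force simp: not_less[symmetric])
  moreover have "inj_on f {y \<in> A. y \<le> x}"
    using strict_mono_on_imp_inj_on[OF assms(1)] by (rule inj_on_subset) auto
  ultimately show ?thesis by (simp add: rank_in_def card_image)
qed

lemma image_rank_in:
  assumes "finite A"
  shows "rank_in A ` A = {1..card A}"
proof (rule card_subset_eq)
  show "rank_in A ` A \<subseteq> {1..card A}"
  proof (rule image_subsetI)
    fix x assume "x \<in> A"
    then have "{y \<in> A. y \<le> x} \<noteq> {}" by auto
    then have "0 < rank_in A x"
      using assms by (simp add: rank_in_def card_gt_0_iff)
    moreover have "rank_in A x \<le> card A"
      using assms unfolding rank_in_def by (intro card_mono) auto
    ultimately show "rank_in A x \<in> {1..card A}" by simp
  qed
  show "card (rank_in A ` A) = card {1..card A}"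
    using card_image[OF inj_on_rank_in[OF assms]] by simp
qed simp

lemma rank_in_insert_smallest:
  assumes "finite A" "\<forall>x\<in>A. a < x"
  shows "rank_in (insert a A) a = 1" "x \<in> A \<Longrightarrow> rank_in (insert a A) x = Suc (rank_in A x)"
proof -
  have "{y \<in> insert a A. y \<le> a} = {a}" using assms(2) by force
  then show "rank_in (insert a A) a = 1" by (simp add: rank_in_def)
next
  assume "x \<in> A"
  then have "{y \<in> insert a A. y \<le> x} = insert a {y \<in> A. y \<le> x}"
    using assms(2) by auto
  moreover have "a \<notin> {y \<in> A. y \<le> x}" using assms(2) by auto
  ultimately show "rank_in (insert a A) x = Suc (rank_in A x)"
    using assms(1) by (simp add: rank_in_def)
qed

lemma length_standardise [simp]: "length (standardise xs) = length xs"
  by (simp add: standardise_def)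

lemma set_standardise: "distinct xs \<Longrightarrow> set (standardise xs) = {1..length xs}"
  by (simp add: standardise_eq_map_rank_in image_rank_in distinct_card)

lemma distinct_standardise: "distinct xs \<Longrightarrow> distinct (standardise xs)"
  by (simp add: standardise_eq_map_rank_in distinct_map inj_on_rank_in)

lemma standardise_map_strict_mono_on:
  assumes "strict_mono_on (set xs) f"
  shows "standardise (map f xs) = standardise xs"
  using rank_in_image[OF assms] by (simp add: standardise_eq_map_rank_in)

lemma standardise_insert_at:
  assumes "\<forall>x\<in>set xs. a < x"
  shows "standardise (insert_at p a xs) = insert_at p 1 (map Suc (standardise xs))"
proof -
  have "map (rank_in (insert a (set xs))) xs = map Suc (standardise xs)"
    using rank_in_insert_smallest(2)[OF finite_set assms]
    by (simp add: standardise_eq_map_rank_in)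
  then show ?thesis
    using rank_in_insert_smallest(1)[OF finite_set assms]
    by (simp add: standardise_eq_map_rank_in[of "insert_at p a xs"] map_insert_at)
qed

lemma same_relative_order_lengthD:
  "same_relative_order xs ys \<Longrightarrow> length xs = length ys"
  unfolding same_relative_order_def by (metis length_standardise)

lemma same_relative_order_iff_eq:
  assumes "set xs = set ys"
  shows "same_relative_order xs ys \<longleftrightarrow> xs = ys"
  using inj_on_rank_in[of "set ys"] assms
  by (simp add: same_relative_order_def standardise_eq_map_rank_in inj_on_map_eq_map)

lemma same_relative_order_insert_at:
  assumes "distinct xs" "\<forall>x\<in>set xs. a < x" "p \<le> length xs"
    and "distinct ys" "\<forall>y\<in>set ys. b < y" "q \<le> length ys"
  shows "same_relative_order (insert_at p a xs) (insert_at q b ys) \<longleftrightarrow>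
    p = q \<and> same_relative_order xs ys"
proof -
  have "1 \<notin> set (map Suc (standardise zs))" if "distinct zs" for zs
    using set_standardise[OF that] by auto
  then show ?thesis
    using assms
    by (simp add: same_relative_order_def standardise_insert_at insert_at_inject inj_map_eq_map)
qed

subsection \<open>Suffix patterns\<close>

definition has_suffix_pattern :: "nat list \<Rightarrow> nat list \<Rightarrow> bool" where
  "has_suffix_pattern ys xs \<longleftrightarrow> same_relative_order (drop (length xs - length ys) xs) ys"

lemma has_suffix_pattern_lengthD: "has_suffix_pattern ys xs \<Longrightarrow> length ys \<le> length xs"
  by (auto simp: has_suffix_pattern_def dest: same_relative_order_lengthD)

lemma has_suffix_pattern_append:
  "length zs = length ys \<Longrightarrow> has_suffix_pattern ys (xs @ zs) \<longleftrightarrow> same_relative_order zs ys"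
  by (simp add: has_suffix_pattern_def)

lemma has_suffix_pattern_insert_at:
  assumes "distinct xs" "\<forall>x\<in>set xs. a < x" "p \<le> length xs"
    and "distinct ys" "\<forall>y\<in>set ys. b < y" "q \<le> length ys"
  defines "k \<equiv> length xs - length ys"
  shows "has_suffix_pattern (insert_at q b ys) (insert_at p a xs) \<longleftrightarrow>
    (if p < k then has_suffix_pattern (insert_at q b ys) xs
     else p = k + q \<and> has_suffix_pattern ys xs)"
proof (cases "p < k")
  case True
  have "length xs - Suc (length ys) = k - 1" by (simp add: k_def)
  then show ?thesis
    using True drop_insert_at_before[OF True assms(3)]
    by (simp add: has_suffix_pattern_def k_def)
next
  case False
  then have "drop k (insert_at p a xs) = insert_at (p - k) a (drop k xs)"
    using assms(3) by (intro drop_insert_at_after) auto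
  moreover have "same_relative_order (insert_at (p - k) a (drop k xs)) (insert_at q b ys) \<longleftrightarrow>
      p - k = q \<and> same_relative_order (drop k xs) ys"
    using assms by (intro same_relative_order_insert_at) (auto dest: in_set_dropD)
  ultimately show ?thesis
    using False by (auto simp: has_suffix_pattern_def k_def)
qed

lemma sum_has_suffix_pattern_insert_at:
  assumes "distinct xs" "\<forall>x\<in>set xs. a < x"
    and "distinct ys" "\<forall>y\<in>set ys. b < y" "q \<le> length ys"
  shows "(\<Sum>p\<le>length xs. of_bool (has_suffix_pattern (insert_at q b ys) (insert_at p a xs))) =
    real (length xs - length ys) * of_bool (has_suffix_pattern (insert_at q b ys) xs) +
    of_bool (has_suffix_pattern ys xs)"
proof -
  define k where "k = length xs - length ys"
  have "(\<Sum>p\<le>length xs. of_bool (has_suffix_pattern (insert_at q b ys) (insert_at p a xs))) =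
      (\<Sum>p\<le>length xs. if p < k then of_bool (has_suffix_pattern (insert_at q b ys) xs) else 0) +
      (\<Sum>p\<le>length xs. if p = k + q then of_bool (has_suffix_pattern ys xs) else (0::real))"
    unfolding sum.distrib[symmetric] using assms
    by (intro sum.cong) (auto simp: has_suffix_pattern_insert_at k_def)
  also have "(\<Sum>p\<le>length xs. if p < k then of_bool (has_suffix_pattern (insert_at q b ys) xs) else 0)
      = real k * of_bool (has_suffix_pattern (insert_at q b ys) xs)"
  proof -
    have "{..length xs} \<inter> {p. p < k} = {..<k}" by (auto simp: k_def)
    then show ?thesis by (simp add: sum.If_cases)
  qed
  also have "(\<Sum>p\<le>length xs. if p = k + q then of_bool (has_suffix_pattern ys xs) else 0) =
      of_bool (has_suffix_pattern ys xs)"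
    using assms(5) by (auto simp: k_def dest: has_suffix_pattern_lengthD)
  finally show ?thesis by (simp add: k_def)
qed

subsection \<open>Removing the top letters\<close>

lemma length_remove_top [simp]: "length (remove_top r xs) = length xs - r"
  by (simp add: remove_top_def)

lemma distinct_remove_top: "distinct xs \<Longrightarrow> distinct (remove_top r xs)"
  by (simp add: remove_top_def distinct_map distinct_standardise)

lemma set_remove_top:
  assumes "distinct xs"
  shows "set (remove_top r xs) = {Suc r..length xs}"
proof -
  have "(+) r ` {1..length xs - r} = {Suc r..length xs}"
    by (cases "r \<le> length xs") auto
  then show ?thesis
    using assms by (simp add: remove_top_def set_standardise)
qed

lemma standardise_drop_remove_top:
  "standardise (drop k (remove_top r xs)) = standardise (drop (k + r) xs)"
proof -
  have "strict_mono_on (set (drop k (drop r xs))) ((+) r \<circ> rank_in (set (drop r xs)))"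
    using strict_mono_onD[OF strict_mono_on_rank_in[OF finite_set[of "drop r xs"]]]
    by (intro strict_mono_onI) (simp only: o_apply nat_add_left_cancel_less in_set_dropD)
  then show ?thesis
    by (simp add: remove_top_def standardise_eq_map_rank_in[of "drop r xs"] drop_map
        standardise_map_strict_mono_on)
qed

lemma has_suffix_pattern_remove_top:
  assumes "length ys + r \<le> length xs"
  shows "has_suffix_pattern ys (remove_top r xs) \<longleftrightarrow> has_suffix_pattern ys xs"
proof -
  have "length xs - r - length ys + r = length xs - length ys" using assms by simp
  then show ?thesis
    by (simp add: has_suffix_pattern_def same_relative_order_def standardise_drop_remove_top)
qed

lemma length_perms: "\<sigma> \<in> perms n \<Longrightarrow> length \<sigma> = n"
  by (simp add: length_finite_permutations_of_set)

lemma remove_top_perms: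
  assumes "\<sigma> \<in> perms n"
  shows "distinct (remove_top r \<sigma>)" "set (remove_top r \<sigma>) = {Suc r..n}"
  using permutations_of_setD(2)[OF assms] length_perms[OF assms]
  by (simp_all add: distinct_remove_top set_remove_top)

subsection \<open>Permutations that extend a given word\<close>

definition insertions :: "nat \<Rightarrow> nat \<Rightarrow> nat list \<Rightarrow> nat list set" where
  "insertions n r w = {\<rho> \<in> perms n. filter (\<lambda>a. r < a) \<rho> = w}"

lemma finite_insertions [simp]: "finite (insertions n r w)"
  by (simp add: insertions_def)

lemma insertions_0:
  assumes "w \<in> perms n"
  shows "insertions n 0 w = {w}"
proof -
  have "filter (\<lambda>a. 0 < a) \<rho> = \<rho>" if "\<rho> \<in> perms n" for \<rho>
    using permutations_of_setD(1)[OF that] by (auto simp: filter_id_conv)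
  then show ?thesis using assms by (auto simp: insertions_def)
qed

lemma insertions_Suc:
  assumes "r < n" "Suc r \<notin> set w"
  shows "insertions n (Suc r) w = (\<Union>p\<le>length w. insertions n r (insert_at p (Suc r) w))"
proof -
  have "filter (\<lambda>a. Suc r < a) \<rho> = w \<longleftrightarrow>
      (\<exists>p\<le>length w. filter (\<lambda>a. r < a) \<rho> = insert_at p (Suc r) w)" if "\<rho> \<in> perms n" for \<rho>
  proof -
    note \<rho> = permutations_of_setD[OF that]
    have "filter (\<lambda>a. Suc r < a) \<rho> = filter (\<lambda>a. Suc r \<noteq> a) (filter (\<lambda>a. r < a) \<rho>)"
      by (auto intro: filter_cong)
    also have "\<dots> = remove1 (Suc r) (filter (\<lambda>a. r < a) \<rho>)"
      using \<rho>(2) by (simp only: distinct_remove1_removeAll distinct_filter removeAll_filter_not_eq)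
    finally show ?thesis
      using \<rho>(1) assms by (simp add: remove1_eq_iff_insert_at)
  qed
  then show ?thesis by (auto simp: insertions_def)
qed

lemma sum_insertions_Suc:
  fixes f :: "nat list \<Rightarrow> 'a::comm_monoid_add"
  assumes "r < n" "Suc r \<notin> set w"
  shows "(\<Sum>\<rho>\<in>insertions n (Suc r) w. f \<rho>) =
    (\<Sum>p\<le>length w. \<Sum>\<rho>\<in>insertions n r (insert_at p (Suc r) w). f \<rho>)"
  unfolding insertions_Suc[OF assms] using insert_at_inject[OF assms(2) assms(2)]
  by (intro sum.UNION_disjoint) (auto simp: insertions_def)

lemma insertions_nonempty:
  assumes "r \<le> n" "distinct w" "set w = {Suc r..n}"
  shows "insertions n r w \<noteq> {}"
proof -
  have "{1..n} = {1..r} \<union> {Suc r..n}" using assms(1) by auto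
  then have "[1..<Suc r] @ w \<in> perms n"
    using assms(2,3) by (intro permutations_of_setI) auto
  moreover have "filter (\<lambda>a. r < a) ([1..<Suc r] @ w) = w"
    using assms(3) by (auto simp: filter_empty_conv filter_id_conv)
  ultimately show ?thesis by (auto simp: insertions_def)
qed

subsection \<open>Eigenfunctions of the insertion of a smallest letter\<close>

text \<open>The subtraction truncates: on words with fewer than \<open>m\<close> letters the sum over the insertions is 0.\<close>

locale insertion_eigenfunction =
  fixes m :: nat and f :: "nat list \<Rightarrow> real"
  assumes sum_insert_at: "distinct xs \<Longrightarrow> \<forall>x\<in>set xs. a < x \<Longrightarrow>
      (\<Sum>p\<le>length xs. f (insert_at p a xs)) = real (Suc (length xs) - m) * f xs"
    and remove_top_invariant: "m + r \<le> length xs \<Longrightarrow> f (remove_top r xs) = f xs"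

lemma insertion_eigenfunction_1: "insertion_eigenfunction 0 (\<lambda>_. 1)"
  by unfold_locales simp_all

definition insertion_contrast :: "nat \<Rightarrow> nat list \<Rightarrow> nat \<Rightarrow> nat \<Rightarrow> nat list \<Rightarrow> real" where
  "insertion_contrast a ys p q xs =
     of_bool (has_suffix_pattern (insert_at p a ys) xs) -
     of_bool (has_suffix_pattern (insert_at q a ys) xs)"

lemma insertion_eigenfunction_insertion_contrast:
  assumes "distinct ys" "\<forall>y\<in>set ys. a < y" "p \<le> length ys" "q \<le> length ys"
  shows "insertion_eigenfunction (Suc (length ys)) (insertion_contrast a ys p q)"
proof
  fix xs b assume "distinct xs" "\<forall>x\<in>set xs. (b::nat) < x"
  then show "(\<Sum>i\<le>length xs. insertion_contrast a ys p q (insert_at i b xs)) =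
      real (Suc (length xs) - Suc (length ys)) * insertion_contrast a ys p q xs"
    using assms
    by (simp add: insertion_contrast_def sum_subtractf sum_has_suffix_pattern_insert_at
        right_diff_distrib del: sum_of_bool_eq)
next
  fix r and xs :: "nat list" assume "Suc (length ys) + r \<le> length xs"
  then show "insertion_contrast a ys p q (remove_top r xs) = insertion_contrast a ys p q xs"
    by (simp add: insertion_contrast_def has_suffix_pattern_remove_top)
qed

lemma fact_Suc_mult_binomial_Suc:
  "fact (Suc k) * (n choose Suc k) = (n - k) * (fact k * (n choose k))"
proof -
  have "fact (Suc k) * (n choose Suc k) = fact k * (Suc k * (n choose Suc k))"
    by (simp only: fact_Suc of_nat_id mult_ac)
  also have "Suc k * (n choose Suc k) = (n - k) * (n choose k)"
    by (simp only: binomial_absorption binomial_absorb_comp)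
  finally show ?thesis by (simp add: mult_ac)
qed

lemma (in insertion_eigenfunction) sum_insertions:
  assumes "r \<le> n" "distinct w" "set w = {Suc r..n}"
  shows "(\<Sum>\<rho>\<in>insertions n r w. f \<rho>) = real (fact r * (n - m choose r)) * f w"
  using assms
proof (induction r arbitrary: w)
  case 0
  then have "w \<in> perms n" by auto
  then show ?case by (simp add: insertions_0)
next
  case (Suc r)
  have notin: "Suc r \<notin> set w" using Suc.prems by simp
  have "length w = n - Suc r"
    using distinct_card[OF Suc.prems(2)] Suc.prems(3) by simp
  then have len: "Suc (length w) - m = n - m - r"
    using Suc.prems(1) by simp
  have "(\<Sum>\<rho>\<in>insertions n (Suc r) w. f \<rho>) =
      (\<Sum>p\<le>length w. \<Sum>\<rho>\<in>insertions n r (insert_at p (Suc r) w). f \<rho>)"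
    using Suc.prems(1) notin by (intro sum_insertions_Suc) auto
  also have "\<dots> = (\<Sum>p\<le>length w. real (fact r * (n - m choose r)) * f (insert_at p (Suc r) w))"
    using Suc.prems notin
    by (intro sum.cong Suc.IH) (simp_all add: Icc_eq_insert_lb_nat[of "Suc r"])
  also have "\<dots> = real (fact r * (n - m choose r)) * (real (n - m - r) * f w)"
    using sum_insert_at[OF Suc.prems(2), of "Suc r"] Suc.prems(3)
    by (simp add: sum_distrib_left[symmetric] len)
  also have "\<dots> = real (fact (Suc r) * (n - m choose Suc r)) * f w"
    by (simp only: fact_Suc_mult_binomial_Suc) (simp add: mult_ac)
  finally show ?case .
qed

lemma card_insertions:
  assumes "r \<le> n" "distinct w" "set w = {Suc r..n}"
  shows "card (insertions n r w) = fact r * (n choose r)"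
proof -
  interpret insertion_eigenfunction 0 "\<lambda>_. 1" by (rule insertion_eigenfunction_1)
  have "real (card (insertions n r w)) = real (fact r * (n choose r))"
    using sum_insertions[OF assms] by simp
  then show ?thesis by (simp only: of_nat_eq_iff)
qed

subsection \<open>The two chains\<close>

lemma set_pmf_top_to_random_std:
  assumes "n > 0" "\<sigma> \<in> perms n"
  shows "set_pmf (top_to_random_std n \<sigma>) \<subseteq> perms n"
proof -
  have "insert_at p 1 (remove_top 1 \<sigma>) \<in> perms n" for p
    using remove_top_perms[OF assms(2), of 1] assms(1)
    by (intro permutations_of_setI) (simp_all add: Icc_eq_insert_lb_nat[of "Suc 0"])
  then show ?thesis by (auto simp: top_to_random_std_def)
qed

lemma set_pmf_binomial_top_to_random_std:
  assumes "0 \<le> q" "q \<le> 1" "\<sigma> \<in> perms n"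
  shows "set_pmf (binomial_top_to_random_std n q \<sigma>) \<subseteq> perms n"
proof -
  have "set_pmf (binomial_pmf n (1 - q)) \<subseteq> {..n}"
    using assms(1,2) by (auto simp: set_pmf_binomial_eq split: if_splits)
  moreover have "set_pmf (pmf_of_set (insertions n r (remove_top r \<sigma>))) \<subseteq> perms n" if "r \<le> n" for r
    using insertions_nonempty[OF that remove_top_perms[OF assms(3)]]
    by (auto simp: set_pmf_of_set insertions_def)
  ultimately show ?thesis
    unfolding binomial_top_to_random_std_def insertions_def[symmetric] set_bind_pmf by blast
qed

lemma sum_binomial_pmf_mult_binomial_ratio:
  fixes q :: real
  assumes "0 \<le> q" "q \<le> 1" "m \<le> n"
  shows "(\<Sum>r\<le>n. pmf (binomial_pmf n (1 - q)) r * (real (n - m choose r) / real (n choose r))) = q ^ m"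
proof -
  have "(\<Sum>r\<le>n. pmf (binomial_pmf n (1 - q)) r * (real (n - m choose r) / real (n choose r))) =
      (\<Sum>r\<le>n. real (n - m choose r) * (1 - q) ^ r * q ^ (n - r))"
    using assms(1,2) by (intro sum.cong) auto
  also have "\<dots> = (\<Sum>r\<le>n - m. real (n - m choose r) * (1 - q) ^ r * q ^ (n - r))"
    by (intro sum.mono_neutral_right) auto
  also have "\<dots> = (\<Sum>r\<le>n - m. q ^ m * (real (n - m choose r) * (1 - q) ^ r * q ^ (n - m - r)))"
    using assms(3) by (intro sum.cong) (auto simp: power_add[symmetric])
  also have "\<dots> = q ^ m"
    using binomial_ring[of "1 - q" q "n - m"] by (simp add: sum_distrib_left[symmetric])
  finally show ?thesis .
qed

context insertion_eigenfunction
begin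

lemma right_eigenfunction_top_to_random_std:
  assumes "n > 0" "m \<le> n"
  shows "right_eigenfunction (perms n) (transition_matrix (top_to_random_std n))
    (real (n - m) / real n) f"
proof (rule right_eigenfunction_transition_matrixI)
  fix \<sigma> assume \<sigma>: "\<sigma> \<in> perms n"
  define w where "w = remove_top 1 \<sigma>"
  have w: "distinct w" "\<forall>x\<in>set w. 1 < x" "Suc (length w) = n"
    using remove_top_perms[OF \<sigma>, of 1] length_perms[OF \<sigma>] assms(1) by (auto simp: w_def)
  have "measure_pmf.expectation (top_to_random_std n \<sigma>) f =
      (\<Sum>p<n. f (insert_at p 1 w)) / real n"
    using assms(1) by (simp add: top_to_random_std_def integral_pmf_of_set lessThan_empty_iff w_def)
  also have "{..<n} = {..length w}" using w(3) by auto
  also have "(\<Sum>p\<le>length w. f (insert_at p 1 w)) = real (n - m) * f w"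
    using sum_insert_at[OF w(1,2)] w(3) by simp
  also have "\<dots> = real (n - m) * f \<sigma>"
    using remove_top_invariant[of 1 \<sigma>] length_perms[OF \<sigma>] assms(2)
    by (cases "m = n") (simp_all add: w_def)
  finally show "measure_pmf.expectation (top_to_random_std n \<sigma>) f = real (n - m) / real n * f \<sigma>"
    by simp
qed (use set_pmf_top_to_random_std assms(1) in auto)

lemma expectation_insertions_remove_top:
  assumes "r \<le> n" "m \<le> n" "\<sigma> \<in> perms n"
  shows "measure_pmf.expectation (pmf_of_set (insertions n r (remove_top r \<sigma>))) f =
    real (n - m choose r) / real (n choose r) * f \<sigma>"
proof -
  note w = assms(1) remove_top_perms[OF assms(3)]
  have "measure_pmf.expectation (pmf_of_set (insertions n r (remove_top r \<sigma>))) f =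
      real (n - m choose r) / real (n choose r) * f (remove_top r \<sigma>)"
    using insertions_nonempty[OF w]
    by (simp add: integral_pmf_of_set sum_insertions[OF w] card_insertions[OF w])
  also have "\<dots> = real (n - m choose r) / real (n choose r) * f \<sigma>"
    using remove_top_invariant[of r \<sigma>] length_perms[OF assms(3)] assms(2)
    by (cases "r \<le> n - m") auto
  finally show ?thesis .
qed

lemma right_eigenfunction_binomial_top_to_random_std:
  assumes "0 \<le> q" "q \<le> 1" "m \<le> n"
  shows "right_eigenfunction (perms n) (transition_matrix (binomial_top_to_random_std n q)) (q ^ m) f"
proof (rule right_eigenfunction_transition_matrixI)
  fix \<sigma> assume \<sigma>: "\<sigma> \<in> perms n"
  define U where "U r = insertions n r (remove_top r \<sigma>)" for r
  have U_nonempty: "U r \<noteq> {}" if "r \<le> n" for r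
    unfolding U_def using that remove_top_perms[OF \<sigma>] by (rule insertions_nonempty)
  have "measure_pmf.expectation (binomial_top_to_random_std n q \<sigma>) f =
      (\<Sum>r\<le>n. pmf (binomial_pmf n (1 - q)) r *\<^sub>R measure_pmf.expectation (pmf_of_set (U r)) f)"
    unfolding binomial_top_to_random_std_def insertions_def[symmetric] U_def[symmetric]
    using assms(1,2) U_nonempty
    by (intro pmf_expectation_bind)
      (auto simp: set_pmf_binomial_eq U_def set_pmf_of_set split: if_splits)
  also have "\<dots> = (\<Sum>r\<le>n. pmf (binomial_pmf n (1 - q)) r *
      (real (n - m choose r) / real (n choose r))) * f \<sigma>"
    unfolding sum_distrib_right U_def using assms(3) \<sigma>
    by (intro sum.cong) (simp_all add: expectation_insertions_remove_top)
  also have "\<dots> = q ^ m * f \<sigma>"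
    by (simp only: sum_binomial_pmf_mult_binomial_ratio[OF assms])
  finally show "measure_pmf.expectation (binomial_top_to_random_std n q \<sigma>) f = q ^ m * f \<sigma>" .
qed (use set_pmf_binomial_top_to_random_std assms in auto)

end

subsection \<open>The functions \<open>f\<^sub>\<tau>\<close>\<close>

lemma fixed_prefix_id_perm [simp]: "fixed_prefix n (id_perm n) = n"
  by (simp add: fixed_prefix_def)

lemma
  assumes "\<tau> \<in> perms n" "\<tau> \<noteq> id_perm n"
  shows fixed_prefix_less: "fixed_prefix n \<tau> < n"
    and nth_fixed_prefix_neq: "\<tau> ! fixed_prefix n \<tau> \<noteq> Suc (fixed_prefix n \<tau>)"
    and nth_less_fixed_prefix: "i < fixed_prefix n \<tau> \<Longrightarrow> \<tau> ! i = Suc i"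
proof -
  define moved where "moved k \<longleftrightarrow> k \<in> {1..n} \<and> letter \<tau> k \<noteq> k" for k
  have "\<exists>i<n. \<tau> ! i \<noteq> Suc i"
  proof (rule ccontr)
    assume "\<not> (\<exists>i<n. \<tau> ! i \<noteq> Suc i)"
    then have "\<tau> = id_perm n"
      using length_perms[OF assms(1)]
      by (intro nth_equalityI) (auto simp: id_perm_def simp del: upt_Suc)
    then show False using assms(2) by simp
  qed
  then obtain i where "i < n" "\<tau> ! i \<noteq> Suc i" by blast
  then have "moved (Suc i)" by (simp add: moved_def letter_def)
  then have least: "moved (LEAST k. moved k)" by (rule LeastI)
  have Least_moved: "(LEAST k. moved k) = Suc (fixed_prefix n \<tau>)"
    using least assms(2) unfolding fixed_prefix_def moved_def by auto
  then have "moved (Suc (fixed_prefix n \<tau>))" using least by simp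
  then show "fixed_prefix n \<tau> < n" "\<tau> ! fixed_prefix n \<tau> \<noteq> Suc (fixed_prefix n \<tau>)"
    by (auto simp: moved_def letter_def)
  then show "\<tau> ! i = Suc i" if "i < fixed_prefix n \<tau>" for i
    using not_less_Least[of "Suc i" moved, unfolded Least_moved] that
    by (simp add: moved_def letter_def)
qed

lemma fixed_prefix_le: "\<tau> \<in> perms n \<Longrightarrow> fixed_prefix n \<tau> \<le> n"
  by (cases "\<tau> = id_perm n") (auto simp: fixed_prefix_less less_imp_le)

lemma fixed_prefix_eq_iff: "\<tau> \<in> perms n \<Longrightarrow> fixed_prefix n \<tau> = n \<longleftrightarrow> \<tau> = id_perm n"
  by (metis fixed_prefix_id_perm fixed_prefix_less less_irrefl)

lemma perms_upt_appendD:
  assumes "[1..<Suc j] @ xs \<in> perms n"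
  shows "distinct xs" "set xs = {Suc j..n}" "n = j + length xs"
proof -
  note upt_append = permutations_of_setD[OF assms]
  have "{1..<Suc j} \<union> set xs = {1..n}" "{1..<Suc j} \<inter> set xs = {}"
    using upt_append by (simp_all only: set_append distinct_append set_upt)
  then have "set xs = {1..n} - {1..<Suc j}" by blast
  also have "\<dots> = {Suc j..n}" by auto
  finally show "set xs = {Suc j..n}" .
  show "distinct xs" using upt_append(2) by simp
  show "n = j + length xs" using length_perms[OF assms] by (simp del: upt_Suc)
qed

text \<open>In this decomposition \<open>p = i - (j + 1)\<close>, which is positive as \<open>\<tau>\<close> does not fix \<open>j + 1\<close>.\<close>

lemma fixed_prefix_decomposition:
  assumes "\<tau> \<in> perms n" "\<tau> \<noteq> id_perm n"
  defines "j \<equiv> fixed_prefix n \<tau>"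
  obtains p ys where "0 < p" "p \<le> length ys" "distinct ys" "set ys = {Suc (Suc j)..n}"
    "\<tau> = [1..<Suc j] @ insert_at p (Suc j) ys"
proof -
  have first_moved: "j < n" "\<tau> ! j \<noteq> Suc j" "\<And>i. i < j \<Longrightarrow> \<tau> ! i = Suc i"
    using fixed_prefix_less nth_fixed_prefix_neq nth_less_fixed_prefix assms by auto
  have "take j \<tau> = [1..<Suc j]"
    using first_moved length_perms[OF assms(1)] by (intro nth_equalityI) (auto simp del: upt_Suc)
  then have \<tau>: "[1..<Suc j] @ drop j \<tau> = \<tau>" by (metis append_take_drop_id)
  note suffix = perms_upt_appendD[of j "drop j \<tau>" n, unfolded \<tau>, OF assms(1)]
  have "Suc j \<in> set (drop j \<tau>)" using suffix(2) first_moved(1) by simp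
  then obtain us vs where split: "drop j \<tau> = us @ Suc j # vs" by (meson split_list)
  have "us \<noteq> []"
    using first_moved(2) nth_via_drop[of j \<tau> "Suc j" vs] split by auto
  moreover have "distinct (us @ vs)" using suffix(1) split by auto
  moreover have "set (us @ vs) = {Suc (Suc j)..n}"
  proof -
    have "set (us @ vs) = set (us @ Suc j # vs) - {Suc j}"
      using suffix(1) unfolding split by auto
    also have "\<dots> = {Suc j..n} - {Suc j}"
      using suffix(2) unfolding split by (rule arg_cong)
    also have "\<dots> = {Suc (Suc j)..n}" by auto
    finally show ?thesis .
  qed
  moreover have "\<tau> = [1..<Suc j] @ insert_at (length us) (Suc j) (us @ vs)"
    using \<tau> split by simp
  ultimately show ?thesis by (intro that[of "length us" "us @ vs"]) auto
qed

lemma position_append_Cons: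
  assumes "xs @ a # ys \<in> perms n"
  shows "position n (xs @ a # ys) a = Suc (length xs)"
  unfolding position_def
proof (rule the_equality)
  let ?\<tau> = "xs @ a # ys"
  note len = length_perms[OF assms]
  show "Suc (length xs) \<in> {1..n} \<and> letter ?\<tau> (Suc (length xs)) = a"
    using len by (auto simp: letter_def)
  fix i assume i: "i \<in> {1..n} \<and> letter ?\<tau> i = a"
  then have "?\<tau> ! (i - 1) = ?\<tau> ! length xs" "i - 1 < length ?\<tau>" "length xs < length ?\<tau>"
    using len by (auto simp: letter_def)
  then have "i - 1 = length xs"
    using permutations_of_setD(2)[OF assms] nth_eq_iff_index_eq by blast
  then show "i = Suc (length xs)" using i by auto
qed

lemma eigfun_id_perm: "\<sigma> \<in> perms n \<Longrightarrow> eigfun n (id_perm n) \<sigma> = 1"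
  by (simp add: eigfun_def)

lemma eigfun_mem_functions_on: "eigfun n \<tau> \<in> functions_on (perms n)"
  by (simp add: functions_on_def eigfun_def)

lemma eigfun_eq_insertion_contrast:
  assumes "\<tau> \<in> perms n" "\<tau> \<noteq> id_perm n"
  defines "j \<equiv> fixed_prefix n \<tau>"
  obtains p ys where "0 < p" "p \<le> length ys" "distinct ys" "set ys = {Suc (Suc j)..n}"
    "\<tau> = [1..<Suc j] @ insert_at p (Suc j) ys"
    "\<And>\<sigma>. \<sigma> \<in> perms n \<Longrightarrow> eigfun n \<tau> \<sigma> = insertion_contrast (Suc j) ys p 0 \<sigma>"
proof -
  obtain p ys where ys: "0 < p" "p \<le> length ys" "distinct ys" "set ys = {Suc (Suc j)..n}"
    and \<tau>: "\<tau> = [1..<Suc j] @ insert_at p (Suc j) ys"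
    using fixed_prefix_decomposition[OF assms(1,2)] unfolding j_def by metis
  let ?\<alpha> = "insert_at p (Suc j) ys" and ?\<alpha>' = "insert_at 0 (Suc j) ys"
  define i where "i = position n \<tau> (Suc j)"
  have "i = Suc (j + p)"
    using position_append_Cons[of "[1..<Suc j] @ take p ys" "Suc j" "drop p ys" n] assms(1) ys(2) \<tau>
    by (simp add: i_def insert_at_def del: upt_Suc)
  then have strings: "drop j \<tau> = ?\<alpha>" "(j + 1) # drop j (take (i - 1) \<tau>) @ drop i \<tau> = ?\<alpha>'"
    using ys(2) by (simp_all add: \<tau> insert_at_def del: upt_Suc)
  have "\<not> same_relative_order ?\<alpha> ?\<alpha>'"
    using ys by (simp add: same_relative_order_insert_at)
  then have exclusive: "\<not> (same_relative_order zs ?\<alpha> \<and> same_relative_order zs ?\<alpha>')" for zs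
    by (simp add: same_relative_order_def)
  have "eigfun n \<tau> \<sigma> = insertion_contrast (Suc j) ys p 0 \<sigma>" if "\<sigma> \<in> perms n" for \<sigma>
  proof -
    have "eigfun n \<tau> \<sigma> = (if same_relative_order (drop j \<sigma>) ?\<alpha> then 1
        else if same_relative_order (drop j \<sigma>) ?\<alpha>' then - 1 else 0)"
      using assms(2) that strings by (simp add: eigfun_def Let_def i_def flip: j_def)
    moreover have "length \<sigma> - Suc (length ys) = j"
      using perms_upt_appendD(3)[OF assms(1)[unfolded \<tau>]] length_perms[OF that] by simp
    ultimately show ?thesis
      using exclusive[of "drop j \<sigma>"] by (simp add: insertion_contrast_def has_suffix_pattern_def)
  qed
  with ys \<tau> show ?thesis by (rule that)
qed

lemma eigfun_insertion_eigenfunction: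
  assumes "\<tau> \<in> perms n"
  obtains f where "insertion_eigenfunction (n - fixed_prefix n \<tau>) f"
    "\<And>\<sigma>. \<sigma> \<in> perms n \<Longrightarrow> eigfun n \<tau> \<sigma> = f \<sigma>"
proof (cases "\<tau> = id_perm n")
  case True
  then show ?thesis using insertion_eigenfunction_1 eigfun_id_perm by (intro that) auto
next
  case False
  define j where "j = fixed_prefix n \<tau>"
  obtain p ys where ys: "0 < p" "p \<le> length ys" "distinct ys" "set ys = {Suc (Suc j)..n}"
    and \<tau>: "\<tau> = [1..<Suc j] @ insert_at p (Suc j) ys"
    and eigfun: "\<And>\<sigma>. \<sigma> \<in> perms n \<Longrightarrow> eigfun n \<tau> \<sigma> = insertion_contrast (Suc j) ys p 0 \<sigma>"
    using eigfun_eq_insertion_contrast[OF assms False] unfolding j_def by metis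
  have "n - j = Suc (length ys)"
    using perms_upt_appendD(3)[OF assms[unfolded \<tau>]] by simp
  then have "insertion_eigenfunction (n - j) (insertion_contrast (Suc j) ys p 0)"
    using ys by (simp add: insertion_eigenfunction_insertion_contrast)
  then show ?thesis using eigfun unfolding j_def by (rule that)
qed

lemma right_eigenfunction_eigfun_top_to_random_std:
  assumes "n > 0" "\<tau> \<in> perms n"
  shows "right_eigenfunction (perms n) (transition_matrix (top_to_random_std n))
    (real (fixed_prefix n \<tau>) / real n) (eigfun n \<tau>)"
proof -
  obtain f where f: "insertion_eigenfunction (n - fixed_prefix n \<tau>) f"
    and eigfun: "\<And>\<sigma>. \<sigma> \<in> perms n \<Longrightarrow> eigfun n \<tau> \<sigma> = f \<sigma>"
    using eigfun_insertion_eigenfunction[OF assms(2)] by blast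
  show ?thesis
    using insertion_eigenfunction.right_eigenfunction_top_to_random_std[OF f assms(1)]
      fixed_prefix_le[OF assms(2)]
    by (simp add: right_eigenfunction_cong[of _ "eigfun n \<tau>" f, OF eigfun])
qed

lemma right_eigenfunction_eigfun_binomial_top_to_random_std:
  assumes "0 \<le> q" "q \<le> 1" "\<tau> \<in> perms n"
  shows "right_eigenfunction (perms n) (transition_matrix (binomial_top_to_random_std n q))
    (q ^ (n - fixed_prefix n \<tau>)) (eigfun n \<tau>)"
proof -
  obtain f where f: "insertion_eigenfunction (n - fixed_prefix n \<tau>) f"
    and eigfun: "\<And>\<sigma>. \<sigma> \<in> perms n \<Longrightarrow> eigfun n \<tau> \<sigma> = f \<sigma>"
    using eigfun_insertion_eigenfunction[OF assms(3)] by blast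
  show ?thesis
    using insertion_eigenfunction.right_eigenfunction_binomial_top_to_random_std[OF f assms(1,2)]
    by (simp add: right_eigenfunction_cong[of _ "eigfun n \<tau>" f, OF eigfun])
qed

lemma eigfun_same_fixed_prefix:
  assumes "\<tau> \<in> perms n" "\<sigma> \<in> perms n" "fixed_prefix n \<tau> = fixed_prefix n \<sigma>"
  shows "eigfun n \<tau> \<sigma> = of_bool (\<tau> = \<sigma>)"
proof -
  have id_iff: "\<tau> = id_perm n \<longleftrightarrow> \<sigma> = id_perm n"
    by (simp only: assms(3) flip: fixed_prefix_eq_iff[OF assms(1)] fixed_prefix_eq_iff[OF assms(2)])
  show ?thesis
  proof (cases "\<tau> = id_perm n")
    case True
    then show ?thesis using id_iff assms(2) eigfun_id_perm by auto
  next
    case False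
    then have \<sigma>_neq: "\<sigma> \<noteq> id_perm n" using id_iff by simp
    define j where "j = fixed_prefix n \<tau>"
    obtain p ys where ys: "0 < p" "p \<le> length ys" "distinct ys" "set ys = {Suc (Suc j)..n}"
      and \<tau>: "\<tau> = [1..<Suc j] @ insert_at p (Suc j) ys"
      and eigfun: "\<And>\<sigma>. \<sigma> \<in> perms n \<Longrightarrow> eigfun n \<tau> \<sigma> = insertion_contrast (Suc j) ys p 0 \<sigma>"
      using eigfun_eq_insertion_contrast[OF assms(1) False] unfolding j_def by metis
    obtain p' ys' where ys': "0 < p'" "p' \<le> length ys'" "distinct ys'" "set ys' = {Suc (Suc j)..n}"
      and \<sigma>: "\<sigma> = [1..<Suc j] @ insert_at p' (Suc j) ys'"
      using fixed_prefix_decomposition[OF assms(2) \<sigma>_neq] unfolding j_def assms(3) by metis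
    have "length ys' = length ys"
      using ys(3,4) ys'(3,4) by (metis distinct_card)
    then have pattern: "has_suffix_pattern (insert_at i (Suc j) ys) \<sigma> \<longleftrightarrow> p' = i \<and> ys' = ys"
      if "i \<le> length ys" for i
      using that ys ys'
      by (simp add: \<sigma> has_suffix_pattern_append same_relative_order_iff_eq insert_at_inject
          del: upt_Suc)
    have "\<tau> = \<sigma> \<longleftrightarrow> p' = p \<and> ys' = ys"
      using insert_at_inject[of "Suc j" ys ys' p p'] ys ys' by (auto simp: \<tau> \<sigma> simp del: upt_Suc)
    then show ?thesis
      using ys(1,2) ys'(1) by (simp add: eigfun[OF assms(2)] insertion_contrast_def pattern)
  qed
qed

lemma independent_family_eigfun:
  assumes "n > 0"
  shows "funs.independent_family (eigfun n) (perms n)"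
proof (rule funs.independent_family_eigenvectors)
  show "Vector_Spaces.linear fscale fscale
      (kernel_operator (perms n) (transition_matrix (top_to_random_std n)))"
    by (rule linear_kernel_operator)
  show "inj_on (\<lambda>j. real j / real n) (fixed_prefix n ` perms n)"
    using assms by (auto simp: inj_on_def)
  show "kernel_operator (perms n) (transition_matrix (top_to_random_std n)) (eigfun n \<tau>) =
      fscale (real (fixed_prefix n \<tau>) / real n) (eigfun n \<tau>)" if "\<tau> \<in> perms n" for \<tau>
    using right_eigenfunction_eigfun_top_to_random_std[OF assms that]
      right_eigenfunction_iff_kernel_operator[OF eigfun_mem_functions_on] by blast
  show "funs.independent_family (eigfun n) {\<tau> \<in> perms n. fixed_prefix n \<tau> = j}" for j
    by (rule funs_independent_family_if_dual_points[where x = "\<lambda>\<tau>. \<tau>"])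
      (auto simp: eigfun_same_fixed_prefix)
qed simp

theorem theorem6p5:
  fixes n :: nat
  assumes "n \<ge> 2"
  shows
    "(\<forall>\<tau> \<in> perms n.
        right_eigenfunction (perms n) (transition_matrix (top_to_random_std n))
          (real (fixed_prefix n \<tau>) / real n) (eigfun n \<tau>))
     \<and> (\<forall>q\<^sub>2 :: real. 0 \<le> q\<^sub>2 \<and> q\<^sub>2 \<le> 1 \<longrightarrow>
          (\<forall>\<tau> \<in> perms n.
            right_eigenfunction (perms n) (transition_matrix (binomial_top_to_random_std n q\<^sub>2))
              (q\<^sub>2 ^ (n - fixed_prefix n \<tau>)) (eigfun n \<tau>)))
     \<and> inj_on (eigfun n) (perms n)
     \<and> is_basis (eigfun n ` perms n) (functions_on (perms n))"
proof (intro conjI ballI allI impI)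
  have n: "n > 0" using assms by simp
  show "right_eigenfunction (perms n) (transition_matrix (top_to_random_std n))
      (real (fixed_prefix n \<tau>) / real n) (eigfun n \<tau>)" if "\<tau> \<in> perms n" for \<tau>
    using n that by (rule right_eigenfunction_eigfun_top_to_random_std)
  show "right_eigenfunction (perms n) (transition_matrix (binomial_top_to_random_std n q))
      (q ^ (n - fixed_prefix n \<tau>)) (eigfun n \<tau>)" if "0 \<le> q \<and> q \<le> 1" "\<tau> \<in> perms n" for q \<tau>
    using that by (intro right_eigenfunction_eigfun_binomial_top_to_random_std) auto
  note family = finite_permutations_of_set independent_family_eigfun[OF n]
  show inj: "inj_on (eigfun n) (perms n)"
    using family by (rule funs.independent_family_imp_inj_on)
  show "is_basis (eigfun n ` perms n) (functions_on (perms n))"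
    using funs.independent_family_imp_independent_image[OF family] card_image[OF inj]
    by (intro is_basis_functions_on_if_card_eq image_subsetI eigfun_mem_functions_on) simp_all
qed

end
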